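(* Let $X$ be a quandle with a connected component $O$ on which the displacement group $\mathrm{Dis}(X)$ acts freely. If the group $\mathrm{Dis}(X)$ is finitely generated, then the metric space $O$ with a displacement metric $d^{\mathrm{Dis}}_U$ ($U$ any finite generating set of $\mathrm{Dis}(X)$) is quasi-isometric to the metric space $\mathrm{Dis}(X)$ with a word metric (with respect to any finite generating set).
   Context: A quandle is a non-empty set $X$ with a binary operation $\triangleleft$ such that (i) $x \triangleleft x = x$ for all $x$; (ii) for every $y \in X$ the map $s_y \colon X \to X$, $s_y(x) = x \triangleleft y$, is a bijection (the point symmetry at $y$); (iii) $(x \triangleleft y)\triangleleft z = (x \triangleleft z)\triangleleft (y \triangleleft z)$ for all $x,y,z$. $\mathrm{Aut}(X)$ is the group of bijective quandle homomorphisms $X\to X$ with product $fg := g \circ f$; it acts on $X$ from the right by $x\cdot f := f(x)$. $\mathrm{Inn}(X)$ is the subgroup of $\mathrm{Aut}(X)$ generated by $\{s_y \mid y \in X\}$, and the displacement group $\mathrm{Dis}(X)$ is the subgroup generated by $\{s_x s_y^{-1} \mid x,y\in X\}$. A connected component of $X$ is an orbit of $\mathrm{Inn}(X)$; the orbits of $\mathrm{Dis}(X)$ on $X$ are the same sets. For a generating set $U$ of $\mathrm{Dis}(X)$, consider the undirected graph with vertex set $X$ in which $x,y$ are joined by an edge if $y = x\cdot u$ for some $u \in U\cup U^{-1}$. Its connected components are the connected components of $X$; the displacement metric $d^{\mathrm{Dis}}_U$ on a connected component is the path metric of this graph (edges have length one). *)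

theory Defs
  imports "HOL-Algebra.Bij" "HOL-Algebra.Generated_Groups" "HOL-Analysis.Abstract_Metric_Spaces"
begin

locale quandle =
  fixes Q :: "'a set" and tri :: "'a \<Rightarrow> 'a \<Rightarrow> 'a"
  assumes nonempty: "Q \<noteq> {}"
    and idem: "x \<in> Q \<Longrightarrow> tri x x = x"
    and bij: "y \<in> Q \<Longrightarrow> bij_betw (\<lambda>x. tri x y) Q Q"
    and self_distrib: "\<lbrakk>x \<in> Q; y \<in> Q; z \<in> Q\<rbrakk> \<Longrightarrow> tri (tri x y) z = tri (tri x z) (tri y z)"

text \<open>Self-maps of \<open>Q\<close> are represented by functions that are \<open>undefined\<close> outside \<open>Q\<close>
  (as in \<^const>\<open>Bij\<close>), so that equality of group elements is equality of maps on \<open>Q\<close>.\<close>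

definition point_symmetry :: "'a set \<Rightarrow> ('a \<Rightarrow> 'a \<Rightarrow> 'a) \<Rightarrow> 'a \<Rightarrow> 'a \<Rightarrow> 'a" where
  "point_symmetry Q tri y = (\<lambda>x\<in>Q. tri x y)"

text \<open>The product is \<open>f g := g \<circ> f\<close>, opposite to that of \<^const>\<open>BijGroup\<close>;
  the right action on \<open>Q\<close> is \<open>x \<cdot> f := f x\<close>.\<close>

definition quandle_Aut :: "'a set \<Rightarrow> ('a \<Rightarrow> 'a \<Rightarrow> 'a) \<Rightarrow> ('a \<Rightarrow> 'a) monoid" where
  "quandle_Aut Q tri =
    \<lparr>carrier = {f \<in> Bij Q. \<forall>x\<in>Q. \<forall>y\<in>Q. f (tri x y) = tri (f x) (f y)},
     mult = (\<lambda>f g. compose Q g f),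
     one = (\<lambda>x\<in>Q. x)\<rparr>"

definition quandle_Inn :: "'a set \<Rightarrow> ('a \<Rightarrow> 'a \<Rightarrow> 'a) \<Rightarrow> ('a \<Rightarrow> 'a) monoid" where
  "quandle_Inn Q tri = (quandle_Aut Q tri)
    \<lparr>carrier := generate (quandle_Aut Q tri) (point_symmetry Q tri ` Q)\<rparr>"

definition quandle_Dis :: "'a set \<Rightarrow> ('a \<Rightarrow> 'a \<Rightarrow> 'a) \<Rightarrow> ('a \<Rightarrow> 'a) monoid" where
  "quandle_Dis Q tri = (quandle_Aut Q tri)
    \<lparr>carrier := generate (quandle_Aut Q tri)
       {point_symmetry Q tri x \<otimes>\<^bsub>quandle_Aut Q tri\<^esub> inv\<^bsub>quandle_Aut Q tri\<^esub> (point_symmetry Q tri y)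
        | x y. x \<in> Q \<and> y \<in> Q}\<rparr>"

definition connected_components_of_quandle :: "'a set \<Rightarrow> ('a \<Rightarrow> 'a \<Rightarrow> 'a) \<Rightarrow> 'a set set" where
  "connected_components_of_quandle Q tri = (\<lambda>x. {f x | f. f \<in> carrier (quandle_Inn Q tri)}) ` Q"

definition acts_freely_on :: "('a \<Rightarrow> 'a) monoid \<Rightarrow> 'a set \<Rightarrow> bool" where
  "acts_freely_on G Y \<longleftrightarrow> (\<forall>g\<in>carrier G. \<forall>y\<in>Y. g y = y \<longrightarrow> g = \<one>\<^bsub>G\<^esub>)"

definition generating_set :: "('g, 'm) monoid_scheme \<Rightarrow> 'g set \<Rightarrow> bool" where
  "generating_set G S \<longleftrightarrow> S \<subseteq> carrier G \<and> generate G S = carrier G"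

definition finitely_generated_group :: "('g, 'm) monoid_scheme \<Rightarrow> bool" where
  "finitely_generated_group G \<longleftrightarrow> (\<exists>S. finite S \<and> generating_set G S)"

definition word_length :: "('g, 'm) monoid_scheme \<Rightarrow> 'g set \<Rightarrow> 'g \<Rightarrow> nat" where
  "word_length G S g =
    (LEAST n. \<exists>w. length w = n \<and> set w \<subseteq> S \<union> set_inv\<^bsub>G\<^esub> S \<and> foldr (\<otimes>\<^bsub>G\<^esub>) w \<one>\<^bsub>G\<^esub> = g)"

text \<open>The value \<open>0\<close> off the carrier only serves \<^locale>\<open>Metric_space\<close>, which demands
  nonnegativity and symmetry on the whole type.\<close>

definition word_metric :: "('g, 'm) monoid_scheme \<Rightarrow> 'g set \<Rightarrow> 'g \<Rightarrow> 'g \<Rightarrow> real" where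
  "word_metric G S g h =
    (if g \<in> carrier G \<and> h \<in> carrier G then real (word_length G S (inv\<^bsub>G\<^esub> g \<otimes>\<^bsub>G\<^esub> h)) else 0)"

definition displacement_graph ::
  "'a set \<Rightarrow> ('a \<Rightarrow> 'a \<Rightarrow> 'a) \<Rightarrow> ('a \<Rightarrow> 'a) set \<Rightarrow> ('a \<times> 'a) set" where
  "displacement_graph Q tri U =
    {(x, y). x \<in> Q \<and> y \<in> Q \<and> (\<exists>u \<in> U \<union> set_inv\<^bsub>quandle_Dis Q tri\<^esub> U. y = u x)}"

text \<open>The path metric: \<open>(x, y) \<in> E ^^ n\<close> says that there is a path of \<open>n\<close> edges from \<open>x\<close> to
  \<open>y\<close>. The value is meaningful only for \<open>x\<close>, \<open>y\<close> in the same connected component.\<close>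

definition displacement_metric ::
  "'a set \<Rightarrow> ('a \<Rightarrow> 'a \<Rightarrow> 'a) \<Rightarrow> ('a \<Rightarrow> 'a) set \<Rightarrow> 'a \<Rightarrow> 'a \<Rightarrow> real" where
  "displacement_metric Q tri U x y = real (LEAST n. (x, y) \<in> displacement_graph Q tri U ^^ n)"

definition quasi_isometry ::
  "'a set \<Rightarrow> ('a \<Rightarrow> 'a \<Rightarrow> real) \<Rightarrow> 'b set \<Rightarrow> ('b \<Rightarrow> 'b \<Rightarrow> real) \<Rightarrow> ('a \<Rightarrow> 'b) \<Rightarrow> bool" where
  "quasi_isometry M d N e f \<longleftrightarrow>
    f \<in> M \<rightarrow> N \<and>
    (\<exists>K\<ge>1. \<exists>C\<ge>0.
      (\<forall>x\<in>M. \<forall>y\<in>M. d x y / K - C \<le> e (f x) (f y) \<and> e (f x) (f y) \<le> K * d x y + C) \<and>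
      (\<forall>z\<in>N. \<exists>x\<in>M. e (f x) z \<le> C))"

definition quasi_isometric ::
  "'a set \<Rightarrow> ('a \<Rightarrow> 'a \<Rightarrow> real) \<Rightarrow> 'b set \<Rightarrow> ('b \<Rightarrow> 'b \<Rightarrow> real) \<Rightarrow> bool" where
  "quasi_isometric M d N e \<longleftrightarrow>
    Metric_space M d \<and> Metric_space N e \<and> (\<exists>f. quasi_isometry M d N e f)"

end

theory Submission
  imports Defs
begin

text \<open>Fix a point \<open>p\<close> of the component. The Inn-orbit of \<open>p\<close> is already its Dis-orbit: moving a
  point \<open>x\<close> by \<open>s\<^sub>y\<close> has the same effect as moving it by \<open>s\<^sub>x\<inverse> s\<^sub>y\<close>, since \<open>s\<^sub>x\<close> fixes \<open>x\<close>, and this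
  product is the displacement \<open>s\<^bsub>y \<triangleleft> x\<^esub> s\<^sub>x\<inverse>\<close> by self-distributivity
  (\<open>Dis_orbit_eq_Inn_orbit\<close>). As Dis acts freely, the orbit map \<open>g \<mapsto> p \<cdot> g\<close> is thus a bijection from
  Dis onto the component.

  The orbit map carries the edge from \<open>g\<close> to \<open>g u\<close> of the Cayley graph to the edge from \<open>p \<cdot> g\<close>
  to \<open>(p \<cdot> g) \<cdot> u\<close>. A path of length \<open>n\<close> from \<open>p \<cdot> g\<close> to \<open>p \<cdot> h\<close> is therefore the same thing as a
  word of length \<open>n\<close> for \<open>g\<inverse> h\<close>, so that the orbit map is an isometry from the word metric of \<open>U\<close>
  to the displacement metric of \<open>U\<close> (\<open>displacement_metric_orbit\<close>). It remains to replace \<open>U\<close> by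
  \<open>S\<close>: word metrics of two finite generating sets are bi-Lipschitz equivalent, because each
  letter of one is a word of bounded length in the other
  (\<open>word_length_le_mult\<close>).\<close>

section \<open>Word metrics\<close>

text \<open>Word length minimises over \<open>n\<close>; keeping \<open>n\<close> exact lets words be matched with graph paths of
  the same length before the minimum is taken.\<close>

definition spelled :: "('g, 'm) monoid_scheme \<Rightarrow> 'g set \<Rightarrow> nat \<Rightarrow> 'g \<Rightarrow> bool" where
  "spelled G S n g \<longleftrightarrow>
    (\<exists>w. length w = n \<and> set w \<subseteq> S \<union> set_inv\<^bsub>G\<^esub> S \<and> foldr (\<otimes>\<^bsub>G\<^esub>) w \<one>\<^bsub>G\<^esub> = g)"

lemma word_length_eq_Least: "word_length G S g = (LEAST n. spelled G S n g)"
  by (simp add: word_length_def spelled_def)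

lemma spelled_0_iff: "spelled G S 0 g \<longleftrightarrow> g = \<one>\<^bsub>G\<^esub>"
  by (auto simp: spelled_def)

lemma spelled_Suc_iff:
  "spelled G S (Suc n) g \<longleftrightarrow>
    (\<exists>a\<in>S \<union> set_inv\<^bsub>G\<^esub> S. \<exists>h. spelled G S n h \<and> g = a \<otimes>\<^bsub>G\<^esub> h)"
proof
  assume "spelled G S (Suc n) g"
  then obtain w where w: "length w = Suc n" "set w \<subseteq> S \<union> set_inv\<^bsub>G\<^esub> S"
    "foldr (\<otimes>\<^bsub>G\<^esub>) w \<one>\<^bsub>G\<^esub> = g"
    by (auto simp: spelled_def)
  then obtain a v where "w = a # v"
    by (cases w) auto
  with w show "\<exists>a\<in>S \<union> set_inv\<^bsub>G\<^esub> S. \<exists>h. spelled G S n h \<and> g = a \<otimes>\<^bsub>G\<^esub> h"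
    unfolding spelled_def by auto
next
  assume "\<exists>a\<in>S \<union> set_inv\<^bsub>G\<^esub> S. \<exists>h. spelled G S n h \<and> g = a \<otimes>\<^bsub>G\<^esub> h"
  then obtain a w where "a \<in> S \<union> set_inv\<^bsub>G\<^esub> S" "length w = n" "set w \<subseteq> S \<union> set_inv\<^bsub>G\<^esub> S"
    "g = a \<otimes>\<^bsub>G\<^esub> foldr (\<otimes>\<^bsub>G\<^esub>) w \<one>\<^bsub>G\<^esub>"
    by (auto simp: spelled_def)
  then show "spelled G S (Suc n) g"
    unfolding spelled_def by (intro exI[of _ "a # w"]) auto
qed

lemma word_length_le: "spelled G S n g \<Longrightarrow> word_length G S g \<le> n"
  unfolding word_length_eq_Least by (rule Least_le)

context group
begin

lemma letters_closed: "S \<subseteq> carrier G \<Longrightarrow> S \<union> set_inv S \<subseteq> carrier G"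
  by (auto simp: SET_INV_def)

lemma inv_letter:
  assumes "S \<subseteq> carrier G" "a \<in> S \<union> set_inv S"
  shows "inv a \<in> S \<union> set_inv S"
  using assms by (auto simp: SET_INV_def)

lemma spelled_closed:
  assumes "S \<subseteq> carrier G" "spelled G S n g"
  shows "g \<in> carrier G"
  using assms(2) letters_closed[OF assms(1)]
  by (induction n arbitrary: g) (auto simp: spelled_0_iff spelled_Suc_iff)

lemma spelled_letter:
  assumes "S \<subseteq> carrier G" "a \<in> S \<union> set_inv S"
  shows "spelled G S 1 a"
proof -
  have "a \<in> carrier G"
    using assms letters_closed by blast
  then have "a = a \<otimes> \<one>"
    by simp
  then show ?thesis
    using assms(2) unfolding One_nat_def spelled_Suc_iff spelled_0_iff by blast
qed

lemma spelled_mult: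
  assumes S: "S \<subseteq> carrier G" and g: "spelled G S m g" and h: "spelled G S n h"
  shows "spelled G S (m + n) (g \<otimes> h)"
  using g
proof (induction m arbitrary: g)
  case 0
  then show ?case
    using h spelled_closed[OF S h] by (simp add: spelled_0_iff)
next
  case (Suc m)
  then obtain a k where ak: "a \<in> S \<union> set_inv S" "spelled G S m k" "g = a \<otimes> k"
    by (auto simp: spelled_Suc_iff)
  moreover from ak have "a \<in> carrier G" "k \<in> carrier G"
    using letters_closed[OF S] spelled_closed[OF S] by blast+
  then have "g \<otimes> h = a \<otimes> (k \<otimes> h)"
    using ak(3) spelled_closed[OF S h] by (simp add: m_assoc)
  ultimately show ?case
    using Suc.IH unfolding add_Suc spelled_Suc_iff by blast
qed

lemma spelled_inv:
  assumes S: "S \<subseteq> carrier G" and "spelled G S n g"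
  shows "spelled G S n (inv g)"
  using assms(2)
proof (induction n arbitrary: g)
  case 0
  then show ?case
    by (simp add: spelled_0_iff)
next
  case (Suc n)
  then obtain a k where ak: "a \<in> S \<union> set_inv S" "spelled G S n k" "g = a \<otimes> k"
    by (auto simp: spelled_Suc_iff)
  have "spelled G S (n + 1) (inv k \<otimes> inv a)"
    using Suc.IH[OF ak(2)] spelled_letter[OF S inv_letter[OF S ak(1)]] by (rule spelled_mult[OF S])
  moreover from ak have "a \<in> carrier G" "k \<in> carrier G"
    using letters_closed[OF S] spelled_closed[OF S] by blast+
  then have "inv g = inv k \<otimes> inv a"
    using ak(3) by (simp add: inv_mult_group)
  ultimately show ?case
    by simp
qed

lemma ex_spelled:
  assumes "generating_set G S" "g \<in> carrier G"
  shows "\<exists>n. spelled G S n g"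
proof -
  have S: "S \<subseteq> carrier G" and "g \<in> generate G S"
    using assms by (auto simp: generating_set_def)
  from this(2) show ?thesis
  proof induction
    case one
    have "spelled G S 0 \<one>"
      by (simp add: spelled_0_iff)
    then show ?case ..
  next
    case (incl a)
    then have "spelled G S 1 a"
      by (intro spelled_letter[OF S]) simp
    then show ?case ..
  next
    case (inv a)
    then have "spelled G S 1 (inv a)"
      by (intro spelled_letter[OF S]) (auto simp: SET_INV_def)
    then show ?case ..
  next
    case (eng g h)
    then obtain m n where "spelled G S m g" "spelled G S n h"
      by blast
    then have "spelled G S (m + n) (g \<otimes> h)"
      by (rule spelled_mult[OF S])
    then show ?case ..
  qed
qed

lemma spelled_word_length:
  assumes "generating_set G S" "g \<in> carrier G"
  shows "spelled G S (word_length G S g) g"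
  unfolding word_length_eq_Least using ex_spelled[OF assms] by (rule LeastI_ex)

lemma word_length_eq_0_iff:
  assumes "generating_set G S" "g \<in> carrier G"
  shows "word_length G S g = 0 \<longleftrightarrow> g = \<one>"
proof
  assume "word_length G S g = 0"
  then show "g = \<one>"
    using spelled_word_length[OF assms] by (simp add: spelled_0_iff)
next
  assume "g = \<one>"
  then show "word_length G S g = 0"
    using word_length_le[of G S 0 g] by (simp add: spelled_0_iff)
qed

lemma word_length_inv:
  assumes S: "generating_set G S" and g: "g \<in> carrier G"
  shows "word_length G S (inv g) = word_length G S g"
proof -
  have *: "word_length G S (inv k) \<le> word_length G S k" if "k \<in> carrier G" for k
    using S spelled_inv[OF _ spelled_word_length[OF S that]]
    by (intro word_length_le) (simp add: generating_set_def)
  show ?thesis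
    using *[of g] *[of "inv g"] g by simp
qed

lemma word_length_mult:
  assumes S: "generating_set G S" and g: "g \<in> carrier G" and h: "h \<in> carrier G"
  shows "word_length G S (g \<otimes> h) \<le> word_length G S g + word_length G S h"
  using S spelled_mult[OF _ spelled_word_length[OF S g] spelled_word_length[OF S h]]
  by (intro word_length_le) (simp add: generating_set_def)

lemma Metric_space_word_metric:
  assumes S: "generating_set G S"
  shows "Metric_space (carrier G) (word_metric G S)"
proof
  fix g h
  show "0 \<le> word_metric G S g h"
    by (simp add: word_metric_def)
  show "word_metric G S g h = word_metric G S h g"
  proof (cases "g \<in> carrier G \<and> h \<in> carrier G")
    case True
    then have "inv (inv g \<otimes> h) = inv h \<otimes> g"
      by (simp add: inv_mult_group)
    then show ?thesis
      using True word_length_inv[OF S, of "inv g \<otimes> h"] by (simp add: word_metric_def)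
  qed (auto simp: word_metric_def)
next
  fix g h assume gh: "g \<in> carrier G" "h \<in> carrier G"
  have "word_metric G S g h = 0 \<longleftrightarrow> inv g \<otimes> h = \<one>"
    using gh word_length_eq_0_iff[OF S, of "inv g \<otimes> h"] by (simp add: word_metric_def)
  also have "\<dots> \<longleftrightarrow> g = h"
    using gh inv_solve_left[of \<one> g h] by auto
  finally show "word_metric G S g h = 0 \<longleftrightarrow> g = h" .
next
  fix g h k assume "g \<in> carrier G" "h \<in> carrier G" "k \<in> carrier G"
  moreover from this have "inv g \<otimes> k = (inv g \<otimes> h) \<otimes> (inv h \<otimes> k)"
    by (simp add: m_assoc[of "inv g" h] m_assoc[of h "inv h", symmetric])
  ultimately show "word_metric G S g k \<le> word_metric G S g h + word_metric G S h k"
    using word_length_mult[OF S, of "inv g \<otimes> h" "inv h \<otimes> k"]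
    by (simp add: word_metric_def flip: of_nat_add)
qed

text \<open>Rewriting every letter of a shortest \<open>S\<close>-word as a \<open>T\<close>-word multiplies its length by at most
  a common bound on the \<open>T\<close>-lengths of the letters; as \<open>S\<close> is finite, their sum is such a bound.\<close>

lemma word_length_le_mult:
  assumes "finite S" and S: "generating_set G S" and T: "generating_set G T"
  shows "\<exists>L. \<forall>g\<in>carrier G. word_length G T g \<le> L * word_length G S g"
proof -
  have Sc: "S \<subseteq> carrier G"
    using S by (simp add: generating_set_def)
  have fin: "finite (S \<union> set_inv S)"
    using \<open>finite S\<close> by (simp add: SET_INV_def)
  define L where "L = (\<Sum>a\<in>S \<union> set_inv S. word_length G T a)"
  have "word_length G T g \<le> L * n" if "spelled G S n g" for n g
    using that
  proof (induction n arbitrary: g)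
    case 0
    then show ?case
      using word_length_eq_0_iff[OF T] by (simp add: spelled_0_iff)
  next
    case (Suc n)
    then obtain a k where ak: "a \<in> S \<union> set_inv S" "spelled G S n k" "g = a \<otimes> k"
      by (auto simp: spelled_Suc_iff)
    then have "word_length G T g \<le> word_length G T a + word_length G T k"
      using word_length_mult[OF T] letters_closed[OF Sc] spelled_closed[OF Sc] by blast
    also have "word_length G T a \<le> L"
      unfolding L_def using ak(1) fin by (intro member_le_sum) auto
    also have "word_length G T k \<le> L * n"
      by (rule Suc.IH[OF ak(2)])
    finally show ?case
      by simp
  qed
  then show ?thesis
    using spelled_word_length[OF S] by blast
qed

end

section \<open>Displacements and connected components\<close>

context quandle
begin

abbreviation Aut where "Aut \<equiv> quandle_Aut Q tri"
abbreviation Inn where "Inn \<equiv> quandle_Inn Q tri"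
abbreviation Dis where "Dis \<equiv> quandle_Dis Q tri"
abbreviation psym where "psym \<equiv> point_symmetry Q tri"

lemma tri_closed: "x \<in> Q \<Longrightarrow> y \<in> Q \<Longrightarrow> tri x y \<in> Q"
  using bij by (auto dest: bij_betwE)

lemma Aut_apply_closed: "f \<in> carrier Aut \<Longrightarrow> x \<in> Q \<Longrightarrow> f x \<in> Q"
  by (auto simp: quandle_Aut_def Bij_def dest: bij_betwE)

lemma Aut_mult_apply: "x \<in> Q \<Longrightarrow> (f \<otimes>\<^bsub>Aut\<^esub> g) x = g (f x)"
  by (simp add: quandle_Aut_def compose_def)

lemma Aut_one_apply: "x \<in> Q \<Longrightarrow> \<one>\<^bsub>Aut\<^esub> x = x"
  by (simp add: quandle_Aut_def)

lemma group_Aut: "group Aut"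
proof (rule groupI)
  fix f g assume fg: "f \<in> carrier Aut" "g \<in> carrier Aut"
  have "compose Q g f \<in> Bij Q"
    using fg by (intro compose_Bij) (auto simp: quandle_Aut_def)
  then show "f \<otimes>\<^bsub>Aut\<^esub> g \<in> carrier Aut"
    using fg Aut_apply_closed[OF fg(1)] by (simp add: quandle_Aut_def compose_eq tri_closed)
next
  show "\<one>\<^bsub>Aut\<^esub> \<in> carrier Aut"
    by (simp add: quandle_Aut_def id_Bij tri_closed)
next
  fix f g h assume "f \<in> carrier Aut" "g \<in> carrier Aut" "h \<in> carrier Aut"
  then show "f \<otimes>\<^bsub>Aut\<^esub> g \<otimes>\<^bsub>Aut\<^esub> h = f \<otimes>\<^bsub>Aut\<^esub> (g \<otimes>\<^bsub>Aut\<^esub> h)"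
    using Aut_apply_closed[of f] by (auto simp: quandle_Aut_def compose_def fun_eq_iff)
next
  fix f assume "f \<in> carrier Aut"
  then show "\<one>\<^bsub>Aut\<^esub> \<otimes>\<^bsub>Aut\<^esub> f = f"
    by (auto simp: quandle_Aut_def Bij_def compose_def fun_eq_iff extensional_def)
next
  fix f assume f: "f \<in> carrier Aut"
  then have fB: "f \<in> Bij Q" and bf: "bij_betw f Q Q"
    by (auto simp: quandle_Aut_def Bij_def)
  define g where "g = (\<lambda>x\<in>Q. inv_into Q f x)"
  have g: "g \<in> Bij Q"
    unfolding g_def by (rule restrict_inv_into_Bij[OF fB])
  have gQ: "g x \<in> Q" and fg: "f (g x) = x" and gf: "g (f x) = x" if "x \<in> Q" for x
    using that bf Aut_apply_closed[OF f that]
    by (auto simp: g_def bij_betw_def inv_into_into f_inv_into_f)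
  have "g (tri x y) = tri (g x) (g y)" if "x \<in> Q" "y \<in> Q" for x y
  proof -
    have "f (tri (g x) (g y)) = tri x y"
      using f that gQ fg by (simp add: quandle_Aut_def)
    then show ?thesis
      using that gQ gf tri_closed by metis
  qed
  then have "g \<in> carrier Aut"
    using g by (simp add: quandle_Aut_def)
  moreover have "g \<otimes>\<^bsub>Aut\<^esub> f = \<one>\<^bsub>Aut\<^esub>"
    using fg by (simp add: quandle_Aut_def compose_def fun_eq_iff)
  ultimately show "\<exists>g\<in>carrier Aut. g \<otimes>\<^bsub>Aut\<^esub> f = \<one>\<^bsub>Aut\<^esub>"
    by blast
qed

lemma Aut_inv_apply:
  assumes "f \<in> carrier Aut" "x \<in> Q"
  shows "(inv\<^bsub>Aut\<^esub> f) (f x) = x"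
  using assms group.r_inv[OF group_Aut]
  by (simp add: Aut_one_apply flip: Aut_mult_apply[of x f "inv\<^bsub>Aut\<^esub> f"])

lemma sym_Aut: "y \<in> Q \<Longrightarrow> psym y \<in> carrier Aut"
  using bij[of y] self_distrib[of _ _ y]
  by (simp add: quandle_Aut_def Bij_def point_symmetry_def tri_closed)

lemma sym_apply: "x \<in> Q \<Longrightarrow> psym y x = tri x y"
  by (simp add: point_symmetry_def)

lemma displacements_subset_Aut:
  "{psym x \<otimes>\<^bsub>Aut\<^esub> inv\<^bsub>Aut\<^esub> (psym y) | x y. x \<in> Q \<and> y \<in> Q} \<subseteq> carrier Aut"
  using sym_Aut group.inv_closed[OF group_Aut] monoid.m_closed[OF group.is_monoid[OF group_Aut]]
  by blast

lemma subgroup_Inn: "subgroup (carrier Inn) Aut"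
  using group.generate_is_subgroup[OF group_Aut, of "psym ` Q"] sym_Aut
  by (auto simp: quandle_Inn_def)

lemma subgroup_Dis: "subgroup (carrier Dis) Aut"
  using group.generate_is_subgroup[OF group_Aut displacements_subset_Aut] by (simp add: quandle_Dis_def)

lemma Dis_eq: "Dis = Aut\<lparr>carrier := carrier Dis\<rparr>"
  by (simp add: quandle_Dis_def)

lemma group_Dis: "group Dis"
  using group.subgroup_imp_group[OF group_Aut subgroup_Dis] Dis_eq by simp

lemma Dis_mult_apply: "x \<in> Q \<Longrightarrow> (f \<otimes>\<^bsub>Dis\<^esub> g) x = g (f x)"
  using Aut_mult_apply by (simp add: quandle_Dis_def)

lemma Dis_one_apply: "x \<in> Q \<Longrightarrow> \<one>\<^bsub>Dis\<^esub> x = x"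
  using Aut_one_apply by (simp add: quandle_Dis_def)

lemma Dis_apply_closed: "f \<in> carrier Dis \<Longrightarrow> x \<in> Q \<Longrightarrow> f x \<in> Q"
  using Aut_apply_closed subgroup.subset[OF subgroup_Dis] by blast

lemma Dis_apply_inv:
  assumes "f \<in> carrier Dis" "x \<in> Q"
  shows "(inv\<^bsub>Dis\<^esub> f) (f x) = x"
  using assms group.r_inv[OF group_Dis]
  by (simp add: Dis_one_apply flip: Dis_mult_apply[of x f "inv\<^bsub>Dis\<^esub> f"])

lemma displacement_in_Dis:
  "x \<in> Q \<Longrightarrow> y \<in> Q \<Longrightarrow> psym x \<otimes>\<^bsub>Aut\<^esub> inv\<^bsub>Aut\<^esub> (psym y) \<in> carrier Dis"
  by (auto simp: quandle_Dis_def intro: generate.incl)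

lemma Dis_subset_Inn: "carrier Dis \<subseteq> carrier Inn"
proof -
  have sym: "psym x \<in> carrier Inn" if "x \<in> Q" for x
    using that by (auto simp: quandle_Inn_def intro: generate.incl)
  have "{psym x \<otimes>\<^bsub>Aut\<^esub> inv\<^bsub>Aut\<^esub> (psym y) | x y. x \<in> Q \<and> y \<in> Q} \<subseteq> carrier Inn"
    using sym subgroup.m_inv_closed[OF subgroup_Inn] subgroup.m_closed[OF subgroup_Inn] by blast
  from group.generate_subgroup_incl[OF group_Aut this subgroup_Inn] show ?thesis
    by (simp add: quandle_Dis_def)
qed

text \<open>On a single point \<open>x\<close>, the symmetry \<open>s\<^sub>y\<close> can be corrected by \<open>s\<^sub>x\<close>, which fixes \<open>x\<close>, to give a
  displacement; the same holds for \<open>s\<^sub>y\<inverse>\<close>. The correction depends on the point, which is why the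
  orbits agree although the groups may differ.\<close>

lemma Inn_apply_eq_Dis_apply:
  assumes "f \<in> carrier Inn" "x \<in> Q"
  shows "\<exists>d\<in>carrier Dis. d x = f x"
proof -
  have "f \<in> generate Aut (psym ` Q)"
    using assms(1) by (simp add: quandle_Inn_def)
  then show ?thesis
    using assms(2)
  proof (induction arbitrary: x)
    case one
    then show ?case
      using subgroup.one_closed[OF subgroup_Dis] by blast
  next
    case (incl f)
    then obtain y where y: "y \<in> Q" "f = psym y" and x: "x \<in> Q"
      by blast
    \<comment> \<open>By self-distributivity \<open>x \<triangleleft> (y \<triangleleft> x) = (x \<triangleleft> x) \<triangleleft> (y \<triangleleft> x) = (x \<triangleleft> y) \<triangleleft> x\<close>, and \<open>s\<^sub>x\<inverse>\<close> undoes the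
        last step.\<close>
    have "tri x (tri y x) = psym x (tri x y)"
      using x y self_distrib[of x y x] idem by (simp add: sym_apply tri_closed)
    then have "(psym (tri y x) \<otimes>\<^bsub>Aut\<^esub> inv\<^bsub>Aut\<^esub> (psym x)) x = f x"
      using x y Aut_inv_apply[OF sym_Aut, of x "tri x y"]
      by (simp add: Aut_mult_apply sym_apply tri_closed)
    then show ?case
      using displacement_in_Dis x y tri_closed by blast
  next
    case (inv f)
    then obtain y where y: "y \<in> Q" "f = psym y" and x: "x \<in> Q"
      by blast
    have "(psym x \<otimes>\<^bsub>Aut\<^esub> inv\<^bsub>Aut\<^esub> (psym y)) x = (inv\<^bsub>Aut\<^esub> f) x"
      using x y idem by (simp add: Aut_mult_apply sym_apply)
    then show ?case
      using displacement_in_Dis x y by blast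
  next
    case (eng f g)
    then obtain d where d: "d \<in> carrier Dis" "d x = f x"
      by blast
    then obtain e where e: "e \<in> carrier Dis" "e (f x) = g (f x)"
      using eng.IH(2)[of "f x"] Dis_apply_closed[OF d(1) eng.prems] by auto
    have "(d \<otimes>\<^bsub>Aut\<^esub> e) x = (f \<otimes>\<^bsub>Aut\<^esub> g) x"
      using d e eng.prems by (simp add: Aut_mult_apply)
    then show ?case
      using subgroup.m_closed[OF subgroup_Dis d(1) e(1)] by blast
  qed
qed

lemma Dis_orbit_eq_Inn_orbit:
  assumes "x \<in> Q"
  shows "{f x | f. f \<in> carrier Inn} = (\<lambda>d. d x) ` carrier Dis"
proof
  show "{f x | f. f \<in> carrier Inn} \<subseteq> (\<lambda>d. d x) ` carrier Dis"
  proof clarify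
    fix f assume "f \<in> carrier Inn"
    then obtain d where "d \<in> carrier Dis" "d x = f x"
      using Inn_apply_eq_Dis_apply assms by blast
    then show "f x \<in> (\<lambda>d. d x) ` carrier Dis"
      by (metis imageI)
  qed
  show "(\<lambda>d. d x) ` carrier Dis \<subseteq> {f x | f. f \<in> carrier Inn}"
    using Dis_subset_Inn by blast
qed

end

section \<open>The displacement graph as a Schreier graph\<close>

lemma sym_relpow: "sym E \<Longrightarrow> sym (E ^^ n)"
proof (induction n)
  case 0
  then show ?case
    by (auto intro: symI)
next
  case (Suc n)
  show ?case
  proof (rule symI)
    fix x y assume "(x, y) \<in> E ^^ Suc n"
    then obtain z where "(x, z) \<in> E ^^ n" "(z, y) \<in> E"
      by auto
    then have "(y, z) \<in> E" "(z, x) \<in> E ^^ n"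
      using Suc by (auto dest: symD)
    then show "(y, x) \<in> E ^^ Suc n"
      by (rule relpow_Suc_I2)
  qed
qed

context quandle
begin

text \<open>The action is on the right, so the letters of a word, read from left to right, are the
  labels of the successive edges of a path.\<close>

lemma displacement_path_iff_spelled:
  assumes U: "U \<subseteq> carrier Dis" and "x \<in> Q"
  shows "(x, y) \<in> displacement_graph Q tri U ^^ n \<longleftrightarrow> (\<exists>g. spelled Dis U n g \<and> y = g x)"
  using assms(2)
proof (induction n arbitrary: x)
  case 0
  then show ?case
    by (auto simp: spelled_0_iff Dis_one_apply)
next
  case (Suc n)
  let ?E = "displacement_graph Q tri U" and ?A = "U \<union> set_inv\<^bsub>Dis\<^esub> U"
  have A: "a x \<in> Q" if "a \<in> ?A" for a
    using that group.letters_closed[OF group_Dis U] Dis_apply_closed Suc.prems by blast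
  have "(x, y) \<in> ?E ^^ Suc n \<longleftrightarrow> (\<exists>z. (x, z) \<in> ?E \<and> (z, y) \<in> ?E ^^ n)"
    by (auto simp del: relpow.simps intro: relpow_Suc_I2 elim: relpow_Suc_E2)
  also have "\<dots> \<longleftrightarrow> (\<exists>a\<in>?A. (a x, y) \<in> ?E ^^ n)"
    using A Suc.prems by (auto simp: displacement_graph_def simp del: Un_iff)
  also have "\<dots> \<longleftrightarrow> (\<exists>a\<in>?A. \<exists>h. spelled Dis U n h \<and> y = h (a x))"
    using A Suc.IH by blast
  also have "\<dots> \<longleftrightarrow> (\<exists>g. spelled Dis U (Suc n) g \<and> y = g x)"
    unfolding spelled_Suc_iff using Dis_mult_apply[OF Suc.prems] by metis
  finally show ?case .
qed

lemma sym_displacement_graph: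
  assumes U: "U \<subseteq> carrier Dis"
  shows "sym (displacement_graph Q tri U)"
proof (rule symI)
  fix x y assume "(x, y) \<in> displacement_graph Q tri U"
  then obtain u where u: "x \<in> Q" "y \<in> Q" "u \<in> U \<union> set_inv\<^bsub>Dis\<^esub> U" "y = u x"
    by (auto simp: displacement_graph_def simp del: Un_iff)
  then have "x = (inv\<^bsub>Dis\<^esub> u) y"
    using Dis_apply_inv group.letters_closed[OF group_Dis U] by auto
  then show "(y, x) \<in> displacement_graph Q tri U"
    using u group.inv_letter[OF group_Dis U] unfolding displacement_graph_def by blast
qed

text \<open>Both sides agree off the component as well, where the predicate under \<open>LEAST\<close> can be
  identically false.\<close>

lemma displacement_metric_commute:
  assumes "U \<subseteq> carrier Dis"
  shows "displacement_metric Q tri U x y = displacement_metric Q tri U y x"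
proof -
  have "(x, y) \<in> displacement_graph Q tri U ^^ n \<longleftrightarrow> (y, x) \<in> displacement_graph Q tri U ^^ n" for n
    using sym_relpow[OF sym_displacement_graph[OF assms]] by (meson symD)
  then show ?thesis
    by (simp add: displacement_metric_def)
qed

section \<open>Free orbits\<close>

text \<open>If \<open>g\<close> and \<open>h\<close> agree at \<open>x\<close>, then \<open>h g\<inverse>\<close> fixes \<open>x\<close>.\<close>

lemma inj_on_orbit_map:
  assumes x: "x \<in> Q" and free: "acts_freely_on Dis ((\<lambda>d. d x) ` carrier Dis)"
  shows "inj_on (\<lambda>d. d x) (carrier Dis)"
proof
  interpret group Dis
    by (rule group_Dis)
  fix g h assume gh: "g \<in> carrier Dis" "h \<in> carrier Dis" "g x = h x"
  then have "(h \<otimes>\<^bsub>Dis\<^esub> inv\<^bsub>Dis\<^esub> g) x = x"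
    using x by (metis Dis_apply_inv Dis_mult_apply)
  moreover have "x \<in> (\<lambda>d. d x) ` carrier Dis"
    using Dis_one_apply[OF x] one_closed by (metis imageI)
  ultimately have "h \<otimes>\<^bsub>Dis\<^esub> inv\<^bsub>Dis\<^esub> g = \<one>\<^bsub>Dis\<^esub>"
    using free gh unfolding acts_freely_on_def by (meson inv_closed m_closed)
  then show "g = h"
    using gh inv_solve_right[of "\<one>\<^bsub>Dis\<^esub>" h g] by simp
qed

text \<open>A path from \<open>x \<cdot> g\<close> to \<open>x \<cdot> h\<close> spells some \<open>k\<close> with \<open>x \<cdot> (g k) = x \<cdot> h\<close>, and freeness forces
  \<open>k = g\<inverse> h\<close>.\<close>

lemma displacement_metric_orbit:
  assumes U: "U \<subseteq> carrier Dis" and x: "x \<in> Q"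
    and free: "acts_freely_on Dis ((\<lambda>d. d x) ` carrier Dis)"
    and gh: "g \<in> carrier Dis" "h \<in> carrier Dis"
  shows "displacement_metric Q tri U (g x) (h x) = word_metric Dis U g h"
proof -
  interpret group Dis
    by (rule group_Dis)
  have "(g x, h x) \<in> displacement_graph Q tri U ^^ n \<longleftrightarrow> spelled Dis U n (inv\<^bsub>Dis\<^esub> g \<otimes>\<^bsub>Dis\<^esub> h)" for n
  proof -
    have "h x = k (g x) \<longleftrightarrow> k = inv\<^bsub>Dis\<^esub> g \<otimes>\<^bsub>Dis\<^esub> h" if k: "k \<in> carrier Dis" for k
    proof -
      have "h x = k (g x) \<longleftrightarrow> h = g \<otimes>\<^bsub>Dis\<^esub> k"
        using inj_on_eq_iff[OF inj_on_orbit_map[OF x free] gh(2) m_closed[OF gh(1) k]]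
        by (simp add: Dis_mult_apply[OF x])
      then show ?thesis
        using inv_solve_left[OF k gh] by simp
    qed
    then show ?thesis
      using displacement_path_iff_spelled[OF U Dis_apply_closed[OF gh(1) x]] spelled_closed[OF U]
      by metis
  qed
  then show ?thesis
    using gh by (simp add: displacement_metric_def word_metric_def word_length_eq_Least)
qed

end

theorem theorem1p4:
  fixes Q C :: "'a set" and tri :: "'a \<Rightarrow> 'a \<Rightarrow> 'a" and U S :: "('a \<Rightarrow> 'a) set"
  assumes "quandle Q tri"
    and "C \<in> connected_components_of_quandle Q tri"
    and "acts_freely_on (quandle_Dis Q tri) C"
    and "finitely_generated_group (quandle_Dis Q tri)"
    and "finite U" and "generating_set (quandle_Dis Q tri) U"
    and "finite S" and "generating_set (quandle_Dis Q tri) S"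
  shows "quasi_isometric C (displacement_metric Q tri U)
           (carrier (quandle_Dis Q tri)) (word_metric (quandle_Dis Q tri) S)"
proof -
  interpret quandle Q tri
    by (rule assms(1))
  interpret group Dis
    by (rule group_Dis)
  note genU = assms(6) and genS = assms(8)
  have U: "U \<subseteq> carrier Dis"
    using genU by (simp add: generating_set_def)
  obtain p where p: "p \<in> Q" and C: "C = (\<lambda>d. d p) ` carrier Dis"
    using assms(2) Dis_orbit_eq_Inn_orbit by (auto simp: connected_components_of_quandle_def)
  have free: "acts_freely_on Dis ((\<lambda>d. d p) ` carrier Dis)"
    using assms(3) C by simp
  define f where "f = inv_into (carrier Dis) (\<lambda>d. d p)"
  have f: "f x \<in> carrier Dis" "(f x) p = x" if "x \<in> C" for x
    using that unfolding C f_def by (auto simp: inv_into_into f_inv_into_f[of x "\<lambda>d. d p"])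
  have f_orbit: "f (g p) = g" if "g \<in> carrier Dis" for g
    using inv_into_f_f[OF inj_on_orbit_map[OF p free] that] by (simp add: f_def)
  have isometry: "displacement_metric Q tri U x y = word_metric Dis U (f x) (f y)"
    if "x \<in> C" "y \<in> C" for x y
    using displacement_metric_orbit[OF U p free, of "f x" "f y"] f that by simp
  interpret DU: Metric_space "carrier Dis" "word_metric Dis U"
    by (rule Metric_space_word_metric[OF genU])
  interpret DS: Metric_space "carrier Dis" "word_metric Dis S"
    by (rule Metric_space_word_metric[OF genS])
  have metric: "Metric_space C (displacement_metric Q tri U)"
  proof
    fix x y
    show "0 \<le> displacement_metric Q tri U x y"
      by (simp add: displacement_metric_def)
    show "displacement_metric Q tri U x y = displacement_metric Q tri U y x"
      by (rule displacement_metric_commute[OF U])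
  next
    fix x y assume "x \<in> C" "y \<in> C"
    then show "displacement_metric Q tri U x y = 0 \<longleftrightarrow> x = y"
      using isometry f DU.zero by metis
  next
    fix x y z assume "x \<in> C" "y \<in> C" "z \<in> C"
    then show "displacement_metric Q tri U x z
      \<le> displacement_metric Q tri U x y + displacement_metric Q tri U y z"
      using isometry f DU.triangle by simp
  qed
  obtain L where L: "\<And>g. g \<in> carrier Dis \<Longrightarrow> word_length Dis S g \<le> L * word_length Dis U g"
    using word_length_le_mult[OF assms(5) genU genS] by blast
  obtain M where M: "\<And>g. g \<in> carrier Dis \<Longrightarrow> word_length Dis U g \<le> M * word_length Dis S g"
    using word_length_le_mult[OF assms(7) genS genU] by blast
  \<comment> \<open>One constant for both directions; the summand 1 makes it a legitimate quasi-isometry factor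
      when \<open>L\<close> and \<open>M\<close> vanish, as they may for the trivial group.\<close>
  define K where "K = real (L + M + 1)"
  have K: "K \<ge> 1"
    by (simp add: K_def)
  have lipschitz: "word_metric Dis S g h \<le> K * word_metric Dis U g h"
    "word_metric Dis U g h \<le> K * word_metric Dis S g h"
    if gh: "g \<in> carrier Dis" "h \<in> carrier Dis" for g h
  proof -
    have k: "inv\<^bsub>Dis\<^esub> g \<otimes>\<^bsub>Dis\<^esub> h \<in> carrier Dis"
      using gh by simp
    show "word_metric Dis S g h \<le> K * word_metric Dis U g h"
      using L[OF k] gh unfolding word_metric_def K_def
      by (simp add: algebra_simps flip: of_nat_mult of_nat_add of_nat_Suc)
    show "word_metric Dis U g h \<le> K * word_metric Dis S g h"
      using M[OF k] gh unfolding word_metric_def K_def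
      by (simp add: algebra_simps flip: of_nat_mult of_nat_add of_nat_Suc)
  qed
  have "displacement_metric Q tri U x y / K \<le> word_metric Dis S (f x) (f y) \<and>
      word_metric Dis S (f x) (f y) \<le> K * displacement_metric Q tri U x y"
    if "x \<in> C" "y \<in> C" for x y
    using lipschitz[of "f x" "f y"] f that isometry K by (simp add: divide_le_eq mult.commute)
  moreover have "\<exists>x\<in>C. word_metric Dis S (f x) g \<le> 0" if "g \<in> carrier Dis" for g
    using that f_orbit[OF that] DS.mdist_zero[OF that] unfolding C by force
  ultimately have "quasi_isometry C (displacement_metric Q tri U) (carrier Dis) (word_metric Dis S) f"
    unfolding quasi_isometry_def using f K
    by (intro conjI exI[of _ K] exI[of _ 0]) auto
  with metric DS.Metric_space_axioms show ?thesis
    unfolding quasi_isometric_def by blast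
qed

end
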